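(* Let $\varphi_1,\varphi_2:\mathbb{M}(n)\to\mathbb{C}$ be positive unital linear functionals, and let $A$ and $B$ be any two elements of $\mathbb{M}(n)$. Then $$\left|\varphi_1(A)-\varphi_2(B)\right|\le s\left(W(A),W(B)\right).$$
   Context: $\mathbb{M}(n)$ is the algebra of all $n\times n$ complex matrices. The inner product on $\mathbb{C}^n$ is $\langle x,y\rangle=\sum_{i=1}^n\overline{x_i}y_i$ and $\|x\|=\langle x,x\rangle^{1/2}$. The numerical range of $A\in\mathbb{M}(n)$ is $W(A)=\{\langle x,Ax\rangle:\|x\|=1\}$. A linear functional $\varphi:\mathbb{M}(n)\to\mathbb{C}$ is positive if $\varphi(A)\ge 0$ whenever $A$ is positive semidefinite, and unital if $\varphi(I)=1$. For $A,B\in\mathbb{M}(n)$, $$s(W(A),W(B))=\max\{|w-w'|:w\in W(A),\ w'\in W(B)\}.$$ *)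

theory Defs
  imports "HOL-Analysis.Analysis"
begin

definition cinner :: "complex ^ 'n \<Rightarrow> complex ^ 'n \<Rightarrow> complex" where
  "cinner x y = (\<Sum>i\<in>UNIV. cnj (x $ i) * y $ i)"

text \<open>The library norm on \<^typ>\<open>complex ^ 'n\<close> is the one induced by \<^const>\<open>cinner\<close>.\<close>

lemma norm_eq_sqrt_cinner:
  "complex_of_real (norm x) = csqrt (cinner x x)"
proof -
  have "cinner x x = of_real ((norm x)\<^sup>2)"
    by (simp add: cinner_def norm_vec_def L2_set_def sum_nonneg complex_norm_square
        mult.commute del: of_real_power)
  then show ?thesis by (simp only: of_real_sqrt[symmetric] zero_le_power2 real_sqrt_abs abs_norm_cancel)
qed

definition numerical_range :: "complex ^ 'n ^ 'n \<Rightarrow> complex set" where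
  "numerical_range A = {cinner x (A *v x) |x. norm x = 1}"

text \<open>Over the complex numbers, the condition below already forces \<open>A\<close> to be Hermitian.\<close>

definition pos_semidef :: "complex ^ 'n ^ 'n \<Rightarrow> bool" where
  "pos_semidef A \<longleftrightarrow> (\<forall>x. cinner x (A *v x) \<in> \<real>\<^sub>\<ge>\<^sub>0)"

text \<open>The library's \<^const>\<open>scaleR\<close> and \<^const>\<open>vector_scalar_mult\<close> on
  \<^typ>\<open>complex ^ 'n ^ 'n\<close> do not provide scaling by a complex number, so it is introduced here.\<close>

definition cscale_mat :: "complex \<Rightarrow> complex ^ 'n ^ 'n \<Rightarrow> complex ^ 'n ^ 'n" where
  "cscale_mat c A = (\<chi> i j. c * A $ i $ j)"

interpretation cscale_mat: vector_space cscale_mat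
  by unfold_locales (simp_all add: cscale_mat_def vec_eq_iff algebra_simps)

definition linear_functional :: "(complex ^ 'n ^ 'n \<Rightarrow> complex) \<Rightarrow> bool" where
  "linear_functional \<phi> \<longleftrightarrow> Vector_Spaces.linear cscale_mat (*) \<phi>"

definition positive_functional :: "(complex ^ 'n ^ 'n \<Rightarrow> complex) \<Rightarrow> bool" where
  "positive_functional \<phi> \<longleftrightarrow> (\<forall>A. pos_semidef A \<longrightarrow> \<phi> A \<in> \<real>\<^sub>\<ge>\<^sub>0)"

definition unital_functional :: "(complex ^ 'n ^ 'n \<Rightarrow> complex) \<Rightarrow> bool" where
  "unital_functional \<phi> \<longleftrightarrow> \<phi> (mat 1) = 1"

definition max_dist :: "complex set \<Rightarrow> complex set \<Rightarrow> real" where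
  "max_dist S T = Sup {cmod (w - w') |w w'. w \<in> S \<and> w' \<in> T}"

text \<open>For numerical ranges the supremum in \<^const>\<open>max_dist\<close> is a maximum.\<close>

lemma compact_numerical_range: "compact (numerical_range A)"
proof -
  have "numerical_range A = (\<lambda>x. cinner x (A *v x)) ` sphere 0 1"
    by (auto simp: numerical_range_def)
  moreover have "continuous_on (sphere 0 1) (\<lambda>x. cinner x (A *v x))"
    unfolding cinner_def matrix_vector_mult_def by (auto intro!: continuous_intros)
  ultimately show ?thesis
    by (metis compact_continuous_image compact_sphere)
qed

lemma numerical_range_nonempty: "numerical_range A \<noteq> {}"
proof -
  have "norm (axis undefined 1 :: complex ^ 'n) = 1" by (simp add: norm_axis_1)
  then show ?thesis unfolding numerical_range_def by blast
qed

lemma max_dist_numerical_range: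
  fixes A B :: "complex ^ 'n ^ 'n"
  shows "\<exists>w\<in>numerical_range A. \<exists>w'\<in>numerical_range B.
           max_dist (numerical_range A) (numerical_range B) = cmod (w - w')"
    and "\<lbrakk>w \<in> numerical_range A; w' \<in> numerical_range B\<rbrakk>
           \<Longrightarrow> cmod (w - w') \<le> max_dist (numerical_range A) (numerical_range B)"
proof -
  let ?D = "{cmod (w - w') |w w'. w \<in> numerical_range A \<and> w' \<in> numerical_range B}"
  have D: "?D = (\<lambda>p. cmod (fst p - snd p)) ` (numerical_range A \<times> numerical_range B)"
    by force
  have c: "compact ?D"
    unfolding D by (intro compact_continuous_image compact_Times compact_numerical_range)
      (auto intro!: continuous_intros)
  have ne: "?D \<noteq> {}"
    unfolding D by (simp add: numerical_range_nonempty Times_empty)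
  have bdd: "bdd_above ?D"
    using c by (simp add: bounded_imp_bdd_above compact_imp_bounded)
  have "Sup ?D \<in> ?D"
    using closed_contains_Sup[OF ne bdd] c compact_imp_closed by blast
  then show "\<exists>w\<in>numerical_range A. \<exists>w'\<in>numerical_range B.
           max_dist (numerical_range A) (numerical_range B) = cmod (w - w')"
    unfolding max_dist_def by blast
  show "cmod (w - w') \<le> max_dist (numerical_range A) (numerical_range B)"
    if "w \<in> numerical_range A" "w' \<in> numerical_range B"
    unfolding max_dist_def using that bdd by (intro cSup_upper) auto
qed

end

(* A positive unital functional commutes with the adjoint, so applying it to the positive
   semidefinite matrix 2 m I - (A + A* ), where m is the maximum of Re w over w in W(A), gives
   Re (phi A) <= m.  Rotating phi1(A) - phi2(B) onto the positive real axis by a unimodular u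
   and using this bound for u A and -u B bounds its modulus by Re (u (w - w')) for some w in W(A)
   and w' in W(B).  Convexity of the numerical range (Toeplitz-Hausdorff) is not needed. *)
theory Submission
  imports Defs
begin

definition conj_transpose :: "complex ^ 'n ^ 'm \<Rightarrow> complex ^ 'm ^ 'n" where
  "conj_transpose A = (\<chi> i j. cnj (A $ j $ i))"

lemma cinner_add_right: "cinner x (y + z) = cinner x y + cinner x z"
  by (simp add: cinner_def algebra_simps sum.distrib)

lemma cinner_cscale_mat: "cinner x (cscale_mat c A *v y) = c * cinner x (A *v y)"
  by (simp add: cinner_def cscale_mat_def matrix_vector_mult_def sum_distrib_left mult_ac)

lemma cinner_conj_transpose: "cinner x (conj_transpose A *v y) = cnj (cinner y (A *v x))"
proof -
  have "cinner x (conj_transpose A *v y) = (\<Sum>i\<in>UNIV. \<Sum>j\<in>UNIV. cnj (x $ i) * (cnj (A $ j $ i) * y $ j))"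
    by (simp add: cinner_def conj_transpose_def matrix_vector_mult_def sum_distrib_left)
  also have "\<dots> = (\<Sum>j\<in>UNIV. \<Sum>i\<in>UNIV. cnj (x $ i) * (cnj (A $ j $ i) * y $ j))"
    by (rule sum.swap)
  also have "\<dots> = cnj (cinner y (A *v x))"
    by (simp add: cinner_def matrix_vector_mult_def sum_distrib_left mult_ac)
  finally show ?thesis .
qed

lemma cinner_self: "cinner x x = of_real ((norm x)\<^sup>2)"
  by (simp add: cinner_def norm_vec_def L2_set_def sum_nonneg complex_norm_square
      mult.commute del: of_real_power)

lemma cinner_scaleR_quadratic:
  "cinner (r *\<^sub>R x) (A *v (r *\<^sub>R x)) = of_real (r\<^sup>2) * cinner x (A *v x)"
  by (simp add: cinner_def matrix_vector_mult_def sum_distrib_left power2_eq_square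
      scaleR_conv_of_real[where 'a = complex] mult_ac)

text \<open>The form \<open>cinner x (A *v x)\<close> scales by the nonnegative factor
  \<open>r\<^sup>2\<close> when \<open>x\<close> scales by a real \<open>r\<close>, so its sign is
  decided on the unit sphere.\<close>

lemma pos_semidefI_numerical_range:
  fixes A :: "complex ^ 'n ^ 'n"
  assumes "numerical_range A \<subseteq> \<real>\<^sub>\<ge>\<^sub>0"
  shows "pos_semidef A"
  unfolding pos_semidef_def
proof
  fix x :: "complex ^ 'n"
  define y where "y = (1 / norm x) *\<^sub>R x"
  show "cinner x (A *v x) \<in> \<real>\<^sub>\<ge>\<^sub>0"
  proof (cases "x = 0")
    case True
    then show ?thesis by (simp add: cinner_def)
  next
    case False
    then have "norm y = 1" and x: "x = norm x *\<^sub>R y"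
      by (simp_all add: y_def)
    then have "cinner y (A *v y) \<in> \<real>\<^sub>\<ge>\<^sub>0"
      using assms by (auto simp: numerical_range_def)
    then have "of_real ((norm x)\<^sup>2) * cinner y (A *v y) \<in> \<real>\<^sub>\<ge>\<^sub>0"
      by (intro nonneg_Reals_mult_I) (auto simp del: of_real_power)
    then show ?thesis
      using cinner_scaleR_quadratic[of "norm x" y A] x by simp
  qed
qed

text \<open>Named after the states of operator algebras. The final proof interprets it once for each
  functional.\<close>

locale state =
  fixes \<phi> :: "complex ^ 'n ^ 'n \<Rightarrow> complex"
  assumes linear: "linear_functional \<phi>"
    and positive: "positive_functional \<phi>"
    and unital: "unital_functional \<phi>"
begin

lemma add: "\<phi> (A + B) = \<phi> A + \<phi> B"
  using linear unfolding linear_functional_def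
  by (rule Vector_Spaces.linear.axioms(3)[THEN module_hom.add])

lemma cscale: "\<phi> (cscale_mat c A) = c * \<phi> A"
  using linear unfolding linear_functional_def
  by (rule Vector_Spaces.linear.axioms(3)[THEN module_hom.scale])

text \<open>On unit vectors the form of \<open>c I + A\<close> takes exactly the values
  \<open>c + w\<close>, so this matrix is positive semidefinite; linearity and unitality send it to
  \<open>c + \<phi> A\<close>.\<close>

lemma nonneg_shift:
  assumes "\<And>w. w \<in> numerical_range A \<Longrightarrow> c + w \<in> \<real>\<^sub>\<ge>\<^sub>0"
  shows "c + \<phi> A \<in> \<real>\<^sub>\<ge>\<^sub>0"
proof -
  have "pos_semidef (cscale_mat c (mat 1) + A)"
    using assms
    by (intro pos_semidefI_numerical_range)
      (fastforce simp: numerical_range_def matrix_vector_mult_add_rdistrib cinner_add_right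
        cinner_cscale_mat cinner_self)
  then have "\<phi> (cscale_mat c (mat 1) + A) \<in> \<real>\<^sub>\<ge>\<^sub>0"
    using positive by (simp add: positive_functional_def)
  then show ?thesis
    using unital by (simp add: add cscale unital_functional_def)
qed

text \<open>A large real multiple of the identity makes the form nonnegative. Since the shift
  \<open>m\<close> is real, it leaves the imaginary part of \<open>\<phi> A\<close>
  unchanged.\<close>

lemma Reals_if_numerical_range:
  assumes "numerical_range A \<subseteq> \<real>"
  shows "\<phi> A \<in> \<real>"
proof -
  obtain m where m: "cmod w \<le> m" if "w \<in> numerical_range A" for w
    using compact_imp_bounded[OF compact_numerical_range] by (meson bounded_iff)
  have "of_real m + w \<in> \<real>\<^sub>\<ge>\<^sub>0" if "w \<in> numerical_range A" for w
    using m[OF that] that assms abs_Re_le_cmod[of w]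
    by (auto simp: complex_nonneg_Reals_iff complex_is_Real_iff subset_iff)
  then have "of_real m + \<phi> A \<in> \<real>\<^sub>\<ge>\<^sub>0"
    by (rule nonneg_shift)
  then show ?thesis
    by (simp add: complex_nonneg_Reals_iff complex_is_Real_iff)
qed

lemma conj_transpose: "\<phi> (conj_transpose A) = cnj (\<phi> A)"
proof -
  have "\<phi> (A + conj_transpose A) \<in> \<real>"
    by (rule Reals_if_numerical_range)
      (auto simp: numerical_range_def matrix_vector_mult_add_rdistrib cinner_add_right
        cinner_conj_transpose complex_is_Real_iff)
  moreover have "\<phi> (cscale_mat \<i> A + cscale_mat (- \<i>) (conj_transpose A)) \<in> \<real>"
    by (rule Reals_if_numerical_range)
      (auto simp: numerical_range_def matrix_vector_mult_add_rdistrib cinner_add_right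
        cinner_cscale_mat cinner_conj_transpose complex_is_Real_iff
        \<comment> \<open>Pulling the sign out of \<open>cscale_mat (- \<i>)\<close> would block
          \<open>cinner_cscale_mat\<close>.\<close>
        simp del: cscale_mat.scale_minus_left)
  ultimately show ?thesis
    by (auto simp: add cscale complex_is_Real_iff complex_eq_iff
        simp del: cscale_mat.scale_minus_left)
qed

lemma Re_le_numerical_range:
  obtains w where "w \<in> numerical_range A" and "Re (\<phi> A) \<le> Re w"
proof -
  \<comment> \<open>The real part attains its maximum on the compact numerical range.\<close>
  have "\<exists>w\<in>numerical_range A. \<forall>v\<in>numerical_range A. Re v \<le> Re w"
    by (intro continuous_attains_sup compact_numerical_range numerical_range_nonempty
        continuous_intros)
  then obtain w where w: "w \<in> numerical_range A"
    and max: "\<And>v. v \<in> numerical_range A \<Longrightarrow> Re v \<le> Re w"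
    by blast
  have "of_real (2 * Re w) + \<phi> (cscale_mat (- 1) (A + conj_transpose A)) \<in> \<real>\<^sub>\<ge>\<^sub>0"
  proof (rule nonneg_shift)
    fix v
    assume "v \<in> numerical_range (cscale_mat (- 1) (A + conj_transpose A))"
    then obtain x where x: "norm x = 1"
      and v: "v = - (cinner x (A *v x) + cnj (cinner x (A *v x)))"
      by (auto simp: numerical_range_def cinner_cscale_mat matrix_vector_mult_add_rdistrib
          cinner_add_right cinner_conj_transpose simp del: cscale_mat.scale_minus_left)
    have "Re (cinner x (A *v x)) \<le> Re w"
      by (rule max) (use x in \<open>auto simp: numerical_range_def\<close>)
    then show "of_real (2 * Re w) + v \<in> \<real>\<^sub>\<ge>\<^sub>0"
      by (simp add: v complex_nonneg_Reals_iff)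
  qed
  \<comment> \<open>By \<open>conj_transpose\<close> the nonnegative number above equals
    \<open>2 * Re w - 2 * Re (\<phi> A)\<close>.\<close>
  then have "Re (\<phi> A) \<le> Re w"
    by (simp add: add cscale conj_transpose complex_nonneg_Reals_iff
        del: cscale_mat.scale_minus_left)
  with w show thesis by (rule that)
qed

text \<open>The numerical range of \<open>u A\<close> is \<open>u\<close> times that of
  \<open>A\<close>, so the previous bound controls \<open>\<phi> A\<close> in every direction of the
  plane.\<close>

lemma Re_mult_le_numerical_range:
  obtains w where "w \<in> numerical_range A" and "Re (u * \<phi> A) \<le> Re (u * w)"
proof -
  obtain v where "v \<in> numerical_range (cscale_mat u A)" and "Re (\<phi> (cscale_mat u A)) \<le> Re v"
    by (rule Re_le_numerical_range)
  moreover from this(1) obtain w where "w \<in> numerical_range A" and "v = u * w"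
    by (auto simp: numerical_range_def cinner_cscale_mat)
  ultimately show thesis
    by (intro that) (simp_all add: cscale)
qed

end

theorem theorem2p1:
  fixes \<phi>1 \<phi>2 :: "complex ^ 'n ^ 'n \<Rightarrow> complex" and A B :: "complex ^ 'n ^ 'n"
  assumes "linear_functional \<phi>1" and "positive_functional \<phi>1" and "unital_functional \<phi>1"
    and "linear_functional \<phi>2" and "positive_functional \<phi>2" and "unital_functional \<phi>2"
  shows "cmod (\<phi>1 A - \<phi>2 B) \<le> max_dist (numerical_range A) (numerical_range B)"
proof -
  interpret s1: state \<phi>1 by (rule state.intro) (use assms in auto)
  interpret s2: state \<phi>2 by (rule state.intro) (use assms in auto)
  define z where "z = \<phi>1 A - \<phi>2 B"
  obtain u where u: "cmod u = 1" and uz: "u * z = of_real (cmod z)"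
  proof (cases "z = 0")
    case True
    \<comment> \<open>Any unimodular number would do here.\<close>
    then show ?thesis using that[of 1] by simp
  next
    case False
    then show ?thesis
      using that[of "cnj z / of_real (cmod z)"]
      by (simp add: norm_divide complex_norm_square[symmetric] power2_eq_square mult.commute[of "cnj z"])
  qed
  obtain w where w: "w \<in> numerical_range A" "Re (u * \<phi>1 A) \<le> Re (u * w)"
    by (rule s1.Re_mult_le_numerical_range)
  \<comment> \<open>The factor \<open>- u\<close> absorbs the minus sign of the difference, so that
    both estimates are upper bounds and can be added.\<close>
  obtain w' where w': "w' \<in> numerical_range B" "Re (- u * \<phi>2 B) \<le> Re (- u * w')"
    by (rule s2.Re_mult_le_numerical_range)
  have "cmod z = Re (u * z)"
    by (simp add: uz)
  also have "\<dots> = Re (u * \<phi>1 A) + Re (- u * \<phi>2 B)"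
    by (simp add: z_def algebra_simps)
  also have "\<dots> \<le> Re (u * w) + Re (- u * w')"
    using w(2) w'(2) by (rule add_mono)
  also have "\<dots> = Re (u * (w - w'))"
    by (simp add: algebra_simps)
  also have "\<dots> \<le> cmod (w - w')"
    using complex_Re_le_cmod[of "u * (w - w')"] by (simp add: norm_mult u)
  also have "\<dots> \<le> max_dist (numerical_range A) (numerical_range B)"
    using w(1) w'(1) by (rule max_dist_numerical_range(2))
  finally show ?thesis by (simp add: z_def)
qed

end
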